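(* Let $X$ be a real linear space and let $\rho$ be a quasi-modular on $X$. Then the functional $$\|x\|_\rho=\inf\{\lambda>0:\rho(x/\lambda)\le 1\}$$ is a quasi-norm on $X_\rho$.
   Context: A function $\rho:X\to[0,\infty]$ on a real linear space $X$ is called a quasi-modular if for all $x,y\in X$: (i) $\rho(0)=0$, and if $\rho(\lambda x)\le 1$ for all $\lambda>0$ then $x=0$; (ii) $\rho(-x)=\rho(x)$; (iii) $\lambda\mapsto\rho(\lambda x)$ is non-decreasing on $[0,\infty)$; (iv) there is a constant $M\ge 1$ (independent of $x,y,\alpha,\beta$) such that $\rho(\alpha x+\beta y)\le M[\rho(x)+\rho(y)]$ whenever $\alpha,\beta\ge 0$, $\alpha+\beta=1$; (v) there is a constant $p>0$ such that for all $\varepsilon>0$ and $A>0$ there exists $K=K(\varepsilon,A)\ge 1$ such that $\rho(ax)\le Ka^p\rho(x)+\varepsilon$ for any $0<a\le 1$ and any $x\in X$ with $\rho(x)\le A$. The quasi-modular space is $X_\rho=\{x\in X:\lim_{\lambda\to 0}\rho(\lambda x)=0\}$, a linear subspace of $X$. A quasi-norm on a real vector space $Y$ is a functional $\|\cdot\|:Y\to[0,\infty)$ such that $\|x\|=0$ iff $x=0$; $\|ax\|=|a|\|x\|$ for $a\in\mathbb R$; and there is $C\ge1$ with $\|x+y\|\le C(\|x\|+\|y\|)$ for all $x,y\in Y$. *)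

theory Defs
  imports Complex_Main "HOL-Library.Extended_Nonnegative_Real"
begin

definition quasi_modular :: "('a::real_vector \<Rightarrow> ennreal) \<Rightarrow> bool" where
  "quasi_modular \<rho> \<longleftrightarrow>
     \<rho> 0 = 0 \<and> (\<forall>x. (\<forall>t>0. \<rho> (t *\<^sub>R x) \<le> 1) \<longrightarrow> x = 0) \<and>
     (\<forall>x. \<rho> (- x) = \<rho> x) \<and>
     (\<forall>x. mono_on {0::real..} (\<lambda>t. \<rho> (t *\<^sub>R x))) \<and>
     (\<exists>M::real. M \<ge> 1 \<and>
        (\<forall>x y. \<forall>\<alpha>\<ge>0. \<forall>\<beta>\<ge>0. \<alpha> + \<beta> = 1 \<longrightarrow>
           \<rho> (\<alpha> *\<^sub>R x + \<beta> *\<^sub>R y) \<le> ennreal M * (\<rho> x + \<rho> y))) \<and>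
     (\<exists>p::real. p > 0 \<and>
        (\<forall>\<epsilon>::real. \<forall>A::real. \<epsilon> > 0 \<longrightarrow> A > 0 \<longrightarrow>
           (\<exists>K::real. K \<ge> 1 \<and>
              (\<forall>a x. 0 < a \<longrightarrow> a \<le> 1 \<longrightarrow> \<rho> x \<le> ennreal A \<longrightarrow>
                 \<rho> (a *\<^sub>R x) \<le> ennreal (K * a powr p) * \<rho> x + ennreal \<epsilon>))))"

definition quasi_modular_space :: "('a::real_vector \<Rightarrow> ennreal) \<Rightarrow> 'a set" where
  "quasi_modular_space \<rho> = {x. ((\<lambda>t::real. \<rho> (t *\<^sub>R x)) \<longlongrightarrow> 0) (at 0)}"

(* The value is \<infinity> when no admissible t exists, so finiteness on the
   quasi-modular space is not built in. *)
definition quasi_modular_norm :: "('a::real_vector \<Rightarrow> ennreal) \<Rightarrow> 'a \<Rightarrow> ennreal" where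
  "quasi_modular_norm \<rho> x = Inf (ennreal ` {t::real. t > 0 \<and> \<rho> (x /\<^sub>R t) \<le> 1})"

(* Quasi-norm on the real vector space Y, realised as a subspace of the type 'a.
   The first conjunct says that Y is a vector space, the second that N takes
   values in [0,\<infinity>) on Y; N is unconstrained outside Y. *)
definition quasi_norm_on :: "'a::real_vector set \<Rightarrow> ('a \<Rightarrow> ennreal) \<Rightarrow> bool" where
  "quasi_norm_on Y N \<longleftrightarrow>
     subspace Y \<and>
     (\<forall>x\<in>Y. N x < \<infinity>) \<and>
     (\<forall>x\<in>Y. N x = 0 \<longleftrightarrow> x = 0) \<and>
     (\<forall>a. \<forall>x\<in>Y. N (a *\<^sub>R x) = ennreal \<bar>a\<bar> * N x) \<and>
     (\<exists>C::real. C \<ge> 1 \<and> (\<forall>x\<in>Y. \<forall>y\<in>Y. N (x + y) \<le> ennreal C * (N x + N y)))"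

end

theory Submission
  imports Defs
begin

text \<open>
  The idea is that \<open>N = quasi_modular_norm \<rho>\<close> is already an extended quasi-norm on the whole
  space: monotonicity of \<open>\<rho>\<close> along rays makes \<open>N\<close> the gauge of the set \<open>{x. \<rho> x \<le> 1}\<close>, so
  definiteness reduces to the first axiom, and evenness of \<open>\<rho>\<close> gives homogeneity.  For the quasi-triangle inequality, quasi-convexity
  puts \<open>(x + y) / (s + t)\<close> into the larger set \<open>{z. \<rho> z \<le> 2 M}\<close> whenever \<open>x / s\<close> and \<open>y / t\<close> lie
  in \<open>{z. \<rho> z \<le> 1}\<close>, and the power-type condition on \<open>\<rho>\<close> supplies one factor \<open>c\<close> that shrinks all
  of the larger set back into the smaller one (\<open>quasi_modular_uniform_shrink\<close>); the constant is
  \<open>1 / c\<close>.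

  The same uniform shrinking shows that \<open>\<rho> (t *\<^sub>R x)\<close> tends to \<open>0\<close> with \<open>t\<close> as soon as it is at most
  \<open>1\<close> for one positive \<open>t\<close>.  Hence \<open>quasi_modular_space \<rho>\<close> is exactly the set where \<open>N\<close> is finite
  (\<open>quasi_modular_space_eq_finite_norm\<close>), and it is a subspace because of the homogeneity and the
  quasi-triangle inequality of \<open>N\<close>.
\<close>

lemma quasi_modular_zero: "quasi_modular \<rho> \<Longrightarrow> \<rho> 0 = 0"
  by (simp add: quasi_modular_def)

lemma quasi_modular_mono:
  assumes "quasi_modular \<rho>" "0 \<le> s" "s \<le> t"
  shows "\<rho> (s *\<^sub>R x) \<le> \<rho> (t *\<^sub>R x)"
  using assms by (auto simp: quasi_modular_def mono_on_def)

lemma quasi_modular_scaleR_abs: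
  assumes "quasi_modular \<rho>"
  shows "\<rho> (\<bar>a\<bar> *\<^sub>R x) = \<rho> (a *\<^sub>R x)"
proof -
  have "\<rho> (- (a *\<^sub>R x)) = \<rho> (a *\<^sub>R x)"
    using assms unfolding quasi_modular_def by blast
  then show ?thesis
    by (simp add: abs_if)
qed

text \<open>
  The gain factor \<open>a powr p\<close> can be made as small as desired, whereas \<open>K\<close> depends only on the
  bound \<open>A\<close> and on the error term; so spending half of \<open>\<epsilon>\<close> on the error term leaves room to choose
  \<open>a\<close> independently of the point.
\<close>

lemma quasi_modular_uniform_shrink:
  assumes "quasi_modular \<rho>" "A > 0" "\<epsilon> > 0"
  obtains c where "0 < c" "c \<le> 1" "\<And>x. \<rho> x \<le> ennreal A \<Longrightarrow> \<rho> (c *\<^sub>R x) \<le> ennreal \<epsilon>"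
proof -
  obtain p where p: "p > 0" and shrink: "\<And>\<epsilon> A. \<lbrakk>\<epsilon> > 0; A > 0\<rbrakk> \<Longrightarrow>
      \<exists>K::real. K \<ge> 1 \<and> (\<forall>a x. 0 < a \<longrightarrow> a \<le> 1 \<longrightarrow> \<rho> x \<le> ennreal A \<longrightarrow>
         \<rho> (a *\<^sub>R x) \<le> ennreal (K * a powr p) * \<rho> x + ennreal \<epsilon>)"
    using assms(1) unfolding quasi_modular_def by metis
  from shrink[of "\<epsilon> / 2" A] assms obtain K where K: "K \<ge> 1"
    and bound: "\<And>a x. \<lbrakk>0 < a; a \<le> 1; \<rho> x \<le> ennreal A\<rbrakk> \<Longrightarrow>
      \<rho> (a *\<^sub>R x) \<le> ennreal (K * a powr p) * \<rho> x + ennreal (\<epsilon> / 2)"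
    by auto
  define q where "q = \<epsilon> / (2 * K * A)"
  have q: "q > 0"
    using K assms by (simp add: q_def)
  define c where "c = min 1 (q powr (1 / p))"
  have c: "0 < c" "c \<le> 1"
    using q by (auto simp: c_def)
  have "c powr p \<le> (q powr (1 / p)) powr p"
    using p c by (intro powr_mono2) (auto simp: c_def)
  also have "\<dots> = q"
    using p q by (simp add: powr_powr)
  finally have "K * c powr p * A \<le> K * q * A"
    using K assms by (intro mult_right_mono mult_left_mono) auto
  also have "\<dots> = \<epsilon> / 2"
    using K assms by (simp add: q_def)
  finally have gain: "K * c powr p * A \<le> \<epsilon> / 2" .
  have "\<rho> (c *\<^sub>R x) \<le> ennreal \<epsilon>" if "\<rho> x \<le> ennreal A" for x
  proof -
    have "\<rho> (c *\<^sub>R x) \<le> ennreal (K * c powr p) * \<rho> x + ennreal (\<epsilon> / 2)"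
      using bound c that by blast
    also have "\<dots> \<le> ennreal (K * c powr p) * ennreal A + ennreal (\<epsilon> / 2)"
      using that by (intro add_right_mono mult_left_mono) auto
    also have "\<dots> = ennreal (K * c powr p * A + \<epsilon> / 2)"
      using K assms by (simp add: ennreal_mult ennreal_plus)
    also have "\<dots> \<le> ennreal \<epsilon>"
      using gain by (intro ennreal_leI) simp
    finally show ?thesis .
  qed
  with c that show thesis
    by blast
qed

lemma quasi_modular_norm_le:
  assumes "t > 0" "\<rho> (x /\<^sub>R t) \<le> 1"
  shows "quasi_modular_norm \<rho> x \<le> ennreal t"
  unfolding quasi_modular_norm_def using assms by (auto intro!: Inf_lower)

lemma quasi_modular_norm_less_topE:
  assumes "quasi_modular_norm \<rho> x < \<infinity>"
  obtains t where "t > 0" "\<rho> (x /\<^sub>R t) \<le> 1"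
  using assms unfolding quasi_modular_norm_def by (auto simp: Inf_less_iff)

lemma quasi_modular_norm_less_imp:
  assumes "quasi_modular \<rho>" "quasi_modular_norm \<rho> x < ennreal t"
  shows "\<rho> (x /\<^sub>R t) \<le> 1"
proof -
  obtain s where s: "s > 0" "\<rho> (x /\<^sub>R s) \<le> 1" "ennreal s < ennreal t"
    using assms(2) unfolding quasi_modular_norm_def by (auto simp: Inf_less_iff)
  then have "\<rho> (x /\<^sub>R t) \<le> \<rho> (x /\<^sub>R s)"
    by (intro quasi_modular_mono[OF assms(1)]) (auto simp: ennreal_less_iff le_imp_inverse_le)
  with s show ?thesis
    by simp
qed

lemma quasi_modular_norm_zero:
  assumes "quasi_modular \<rho>"
  shows "quasi_modular_norm \<rho> 0 = 0"
proof -
  have "quasi_modular_norm \<rho> 0 \<le> 0 + ennreal e" if "e > 0" for e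
    using quasi_modular_norm_le[of e \<rho> 0] that quasi_modular_zero[OF assms] by simp
  then show ?thesis
    by (metis ennreal_le_epsilon le_zero_eq)
qed

lemma quasi_modular_norm_eq_zero_iff:
  assumes "quasi_modular \<rho>"
  shows "quasi_modular_norm \<rho> x = 0 \<longleftrightarrow> x = 0"
proof
  assume zero: "quasi_modular_norm \<rho> x = 0"
  have "\<rho> (t *\<^sub>R x) \<le> 1" if "t > 0" for t
    using quasi_modular_norm_less_imp[OF assms, of x "inverse t"] zero that by simp
  then show "x = 0"
    using assms unfolding quasi_modular_def by blast
qed (simp add: quasi_modular_norm_zero[OF assms])

lemma quasi_modular_norm_scaleR_le:
  assumes "quasi_modular \<rho>" "a \<noteq> 0"
  shows "quasi_modular_norm \<rho> (a *\<^sub>R x) \<le> ennreal \<bar>a\<bar> * quasi_modular_norm \<rho> x"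
proof -
  have "quasi_modular_norm \<rho> (a *\<^sub>R x) / ennreal \<bar>a\<bar> \<le> ennreal t"
    if t: "t > 0" "\<rho> (x /\<^sub>R t) \<le> 1" for t
  proof -
    have "\<bar>inverse (\<bar>a\<bar> * t) * a\<bar> = inverse t"
      using t assms(2) by (simp add: abs_mult)
    then have "\<rho> ((a *\<^sub>R x) /\<^sub>R (\<bar>a\<bar> * t)) = \<rho> (x /\<^sub>R t)"
      using quasi_modular_scaleR_abs[OF assms(1), of "inverse (\<bar>a\<bar> * t) * a" x]
      by (simp only: scaleR_scaleR)
    then have "quasi_modular_norm \<rho> (a *\<^sub>R x) \<le> ennreal (\<bar>a\<bar> * t)"
      using t assms(2) by (intro quasi_modular_norm_le) auto
    then have "quasi_modular_norm \<rho> (a *\<^sub>R x) / ennreal \<bar>a\<bar> \<le> ennreal (\<bar>a\<bar> * t) / ennreal \<bar>a\<bar>"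
      by (rule divide_right_mono_ennreal)
    also have "\<dots> = ennreal t"
      using t assms(2) by (simp add: divide_ennreal)
    finally show ?thesis .
  qed
  then have "quasi_modular_norm \<rho> (a *\<^sub>R x) / ennreal \<bar>a\<bar> \<le> quasi_modular_norm \<rho> x"
    unfolding quasi_modular_norm_def[of \<rho> x] by (auto intro!: Inf_greatest)
  then have "ennreal \<bar>a\<bar> * (quasi_modular_norm \<rho> (a *\<^sub>R x) / ennreal \<bar>a\<bar>)
      \<le> ennreal \<bar>a\<bar> * quasi_modular_norm \<rho> x"
    by (rule mult_left_mono) simp
  moreover have "ennreal \<bar>a\<bar> * (quasi_modular_norm \<rho> (a *\<^sub>R x) / ennreal \<bar>a\<bar>)
      = quasi_modular_norm \<rho> (a *\<^sub>R x)"
    using assms(2) by (subst ennreal_times_divide, subst mult.commute) (simp add: mult_divide_eq_ennreal)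
  ultimately show ?thesis
    by simp
qed

text \<open>
  For \<open>a \<noteq> 0\<close> the reverse inequality is the previous estimate for the factor \<open>1 / a\<close>.  For \<open>a = 0\<close>
  the identity persists where the norm is infinite, because \<open>0 * \<infinity> = 0\<close>.
\<close>

lemma quasi_modular_norm_scaleR:
  assumes "quasi_modular \<rho>"
  shows "quasi_modular_norm \<rho> (a *\<^sub>R x) = ennreal \<bar>a\<bar> * quasi_modular_norm \<rho> x"
proof (cases "a = 0")
  case True
  then show ?thesis
    using quasi_modular_norm_zero[OF assms] by simp
next
  case False
  have "ennreal \<bar>a\<bar> * quasi_modular_norm \<rho> x
      \<le> ennreal \<bar>a\<bar> * (ennreal \<bar>inverse a\<bar> * quasi_modular_norm \<rho> (a *\<^sub>R x))"
    using quasi_modular_norm_scaleR_le[OF assms, of "inverse a" "a *\<^sub>R x"] False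
    by (intro mult_left_mono) auto
  also have "\<dots> = quasi_modular_norm \<rho> (a *\<^sub>R x)"
    using False by (simp flip: ennreal_mult mult.assoc add: abs_mult[symmetric])
  finally show ?thesis
    using quasi_modular_norm_scaleR_le[OF assms False] by (intro antisym)
qed

text \<open>
  Quasi-convexity alone bounds \<open>\<rho> ((x + y) /\<^sub>R (s + t))\<close> by \<open>2 * M\<close>, and \<open>M \<ge> 1\<close>, so \<open>s + t\<close>
  need not be admissible for \<open>x + y\<close>; after the uniform shrinking by \<open>c\<close>, the scale \<open>(s + t) / c\<close>
  is.  Since \<open>c\<close> depends only on \<open>M\<close>, the same constant serves all points.
\<close>

lemma quasi_modular_norm_triangle:
  assumes "quasi_modular \<rho>"
  obtains C :: real where "C \<ge> 1"
    "\<And>x y. quasi_modular_norm \<rho> (x + y)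
        \<le> ennreal C * (quasi_modular_norm \<rho> x + quasi_modular_norm \<rho> y)"
proof -
  let ?N = "quasi_modular_norm \<rho>"
  obtain M :: real where M: "M \<ge> 1" and convex: "\<And>x y \<alpha> \<beta>. \<lbrakk>\<alpha> \<ge> 0; \<beta> \<ge> 0; \<alpha> + \<beta> = 1\<rbrakk> \<Longrightarrow>
      \<rho> (\<alpha> *\<^sub>R x + \<beta> *\<^sub>R y) \<le> ennreal M * (\<rho> x + \<rho> y)"
    using assms unfolding quasi_modular_def by metis
  obtain c where c: "0 < c" "c \<le> 1"
    and shrink: "\<And>x. \<rho> x \<le> ennreal (2 * M) \<Longrightarrow> \<rho> (c *\<^sub>R x) \<le> 1"
    using quasi_modular_uniform_shrink[OF assms, of "2 * M" 1] M by auto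
  have sum_le: "?N (x + y) \<le> ennreal (1 / c) * (ennreal s + ennreal t)"
    if s: "s > 0" "\<rho> (x /\<^sub>R s) \<le> 1" and t: "t > 0" "\<rho> (y /\<^sub>R t) \<le> 1" for x y s t
  proof -
    have "(x + y) /\<^sub>R (s + t) = (s / (s + t)) *\<^sub>R (x /\<^sub>R s) + (t / (s + t)) *\<^sub>R (y /\<^sub>R t)"
      using s t by (simp add: scaleR_add_right divide_simps)
    also have "\<rho> \<dots> \<le> ennreal M * (\<rho> (x /\<^sub>R s) + \<rho> (y /\<^sub>R t))"
      using s t by (intro convex) (auto simp flip: add_divide_distrib)
    also have "\<dots> \<le> ennreal M * (1 + 1)"
      using s t by (intro mult_left_mono add_mono) auto
    also have "\<dots> = ennreal (2 * M)"
      using M by (simp add: ennreal_mult mult.commute)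
    finally have "\<rho> (c *\<^sub>R ((x + y) /\<^sub>R (s + t))) \<le> 1"
      by (rule shrink)
    moreover have "c *\<^sub>R ((x + y) /\<^sub>R (s + t)) = (x + y) /\<^sub>R ((1 / c) * (s + t))"
      by (simp add: divide_inverse)
    ultimately have "\<rho> ((x + y) /\<^sub>R ((1 / c) * (s + t))) \<le> 1"
      by (simp only:)
    then have "?N (x + y) \<le> ennreal ((1 / c) * (s + t))"
      using s t c by (intro quasi_modular_norm_le) simp_all
    also have "\<dots> = ennreal (1 / c) * (ennreal s + ennreal t)"
      using s t c by (simp add: ennreal_mult ennreal_plus del: times_divide_eq_left)
    finally show ?thesis .
  qed
  have "?N (x + y) \<le> ennreal (1 / c) * (?N x + ?N y)" for x y
  proof (cases "?N x < \<infinity> \<and> ?N y < \<infinity>")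
    case False
    then have "?N x + ?N y = top"
      by (auto simp: not_less top_unique)
    then have "ennreal (1 / c) * (?N x + ?N y) = top"
      using c by (simp only: ennreal_mult_eq_top_iff) simp
    then show ?thesis
      by (simp only: top_greatest)
  next
    case True
    then obtain r1 r2 where r: "?N x = ennreal r1" "?N y = ennreal r2" "0 \<le> r1" "0 \<le> r2"
      by (metis ennreal_cases infinity_ennreal_def less_irrefl)
    show ?thesis
    proof (rule ennreal_le_epsilon)
      fix e :: real
      assume e: "e > 0"
      \<comment> \<open>The infimum need not be attained: each summand is raised by \<open>d\<close>, which costs \<open>2 * d / c = e\<close>.\<close>
      define d where "d = c * e / 2"
      have d: "d > 0"
        using c e by (simp add: d_def)
      have "?N (x + y) \<le> ennreal (1 / c) * (ennreal (r1 + d) + ennreal (r2 + d))"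
        using r d by (intro sum_le quasi_modular_norm_less_imp[OF assms])
          (auto simp: ennreal_less_iff)
      also have "\<dots> = ennreal ((1 / c) * (r1 + r2) + e)"
        using r d c by (simp add: d_def field_simps flip: ennreal_mult ennreal_plus)
      also have "\<dots> = ennreal (1 / c) * (?N x + ?N y) + ennreal e"
        using r c e by (simp add: ennreal_mult ennreal_plus del: times_divide_eq_left)
      finally show "?N (x + y) \<le> ennreal (1 / c) * (?N x + ?N y) + ennreal e" .
    qed
  qed
  with c that[of "1 / c"] show thesis
    by simp
qed

text \<open>
  A finite norm provides a multiple of \<open>x\<close> with modular at most \<open>1\<close>.  Shrinking it once brings the
  modular down to any given \<open>\<epsilon>\<close>, and monotonicity and evenness extend that bound to all smaller multiples of
  either sign, which is the two-sided limit at \<open>0\<close>.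
\<close>

lemma quasi_modular_space_eq_finite_norm:
  assumes "quasi_modular \<rho>"
  shows "quasi_modular_space \<rho> = {x. quasi_modular_norm \<rho> x < \<infinity>}"
proof (intro equalityI subsetI CollectI)
  fix x
  assume "x \<in> quasi_modular_space \<rho>"
  then have "((\<lambda>t. \<rho> (t *\<^sub>R x)) \<longlongrightarrow> 0) (at_right 0)"
    unfolding quasi_modular_space_def by (simp add: filterlim_at_split)
  then have "eventually (\<lambda>t. \<rho> (t *\<^sub>R x) < 1) (at_right 0)"
    by (rule order_tendstoD) simp
  then obtain b where b: "b > 0" "\<And>t. \<lbrakk>t > 0; t < b\<rbrakk> \<Longrightarrow> \<rho> (t *\<^sub>R x) < 1"
    unfolding eventually_at_right_field by blast
  then have "quasi_modular_norm \<rho> x \<le> ennreal (inverse (b / 2))"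
    using b(1) less_imp_le[OF b(2)[of "b / 2"]] by (intro quasi_modular_norm_le) auto
  also have "\<dots> < \<infinity>"
    by simp
  finally show "quasi_modular_norm \<rho> x < \<infinity>" .
next
  fix x
  assume "x \<in> {x. quasi_modular_norm \<rho> x < \<infinity>}"
  then have "quasi_modular_norm \<rho> x < \<infinity>"
    by simp
  then obtain t where t: "t > 0" "\<rho> (x /\<^sub>R t) \<le> 1"
    by (rule quasi_modular_norm_less_topE)
  have "eventually (\<lambda>s. \<rho> (s *\<^sub>R x) < e) (at 0)" if "e > 0" for e
  proof -
    obtain \<epsilon> where \<epsilon>: "\<epsilon> > 0" "ennreal \<epsilon> < e"
    proof -
      obtain d where d: "0 < d" "d < e"
        using dense[OF \<open>e > 0\<close>] by blast
      then obtain \<epsilon> where "d = ennreal \<epsilon>"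
        by (cases d) auto
      with d that show thesis
        by simp
    qed
    obtain c where c: "c > 0" and shrink: "\<And>y. \<rho> y \<le> ennreal 1 \<Longrightarrow> \<rho> (c *\<^sub>R y) \<le> ennreal \<epsilon>"
      using quasi_modular_uniform_shrink[OF assms zero_less_one \<epsilon>(1)] by blast
    have "\<rho> (c *\<^sub>R (x /\<^sub>R t)) \<le> ennreal \<epsilon>"
      by (rule shrink) (use t in simp)
    then have small: "\<rho> ((c / t) *\<^sub>R x) \<le> ennreal \<epsilon>"
      by (simp add: divide_inverse)
    have "\<rho> (s *\<^sub>R x) < e" if "\<bar>s\<bar> < c / t" for s
    proof -
      have "\<rho> (s *\<^sub>R x) = \<rho> (\<bar>s\<bar> *\<^sub>R x)"
        by (simp only: quasi_modular_scaleR_abs[OF assms])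
      also have "\<dots> \<le> \<rho> ((c / t) *\<^sub>R x)"
        using that by (intro quasi_modular_mono[OF assms]) auto
      also have "\<dots> \<le> ennreal \<epsilon>"
        by (rule small)
      also have "\<dots> < e"
        by fact
      finally show ?thesis .
    qed
    then show ?thesis
      using c t unfolding eventually_at by (intro exI[of _ "c / t"]) (auto simp: dist_real_def)
  qed
  then show "x \<in> quasi_modular_space \<rho>"
    unfolding quasi_modular_space_def by (intro CollectI order_tendstoI) simp_all
qed

theorem theorem3p4:
  fixes \<rho> :: "'a::real_vector \<Rightarrow> ennreal"
  assumes "quasi_modular \<rho>"
  shows "quasi_norm_on (quasi_modular_space \<rho>) (quasi_modular_norm \<rho>)"
proof -
  let ?N = "quasi_modular_norm \<rho>"
  obtain C :: real where C: "C \<ge> 1" "\<And>x y. ?N (x + y) \<le> ennreal C * (?N x + ?N y)"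
    using quasi_modular_norm_triangle[OF assms] by blast
  have "?N (x + y) < \<infinity>" if "?N x < \<infinity>" "?N y < \<infinity>" for x y
    using C(2)[of x y] that by (auto simp: ennreal_mult_less_top elim!: le_less_trans)
  moreover have "?N (a *\<^sub>R x) < \<infinity>" if "?N x < \<infinity>" for a x
    using that by (simp add: quasi_modular_norm_scaleR[OF assms] ennreal_mult_less_top)
  ultimately have "subspace (quasi_modular_space \<rho>)"
    unfolding quasi_modular_space_eq_finite_norm[OF assms]
    by (auto simp: subspace_def quasi_modular_norm_zero[OF assms])
  then show ?thesis
    unfolding quasi_norm_on_def
    using C quasi_modular_norm_eq_zero_iff[OF assms] quasi_modular_norm_scaleR[OF assms]
      quasi_modular_space_eq_finite_norm[OF assms]
    by auto
qed

end
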